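(* The total coloring conjecture holds for every mock threshold graph: if $G$ is a mock threshold graph with maximum degree $\Delta(G)$, then $\chi''(G)\le \Delta(G)+2$.
   Context: All graphs are finite, simple and undirected. A total coloring of a graph $G$ is a map $f: V(G)\cup E(G)\to C$ ($C$ a set of colors) such that adjacent vertices receive different colors, edges sharing an endpoint receive different colors, and every edge receives a color different from those of its two endpoints. The total chromatic number $\chi''(G)$ is the minimum number of colors in a total coloring of $G$. The total coloring conjecture for $G$ is the inequality $\chi''(G)\le\Delta(G)+2$. A graph $G$ on $n$ vertices is mock threshold if there is an ordering $v_1,\dots,v_n$ of its vertices such that for every $1\le i\le n$, the degree of $v_i$ in the subgraph of $G$ induced by $\{v_1,\dots,v_i\}$ is $0$, $1$, $i-2$ or $i-1$. *)

theory Defs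
  imports "HOL-Library.Ramsey"
begin

text \<open>A graph is given by its vertex set \<open>V\<close> and its set \<open>E\<close> of two-element edges.\<close>

definition fin_simple_graph :: "'a set \<Rightarrow> 'a set set \<Rightarrow> bool" where
  "fin_simple_graph V E \<longleftrightarrow> finite V \<and> E \<subseteq> nsets V 2"

definition vertex_degree :: "'a set set \<Rightarrow> 'a \<Rightarrow> nat" where
  "vertex_degree E v = card {e \<in> E. v \<in> e}"

text \<open>The inserted \<open>0\<close> only matters for the graph without vertices.\<close>

definition max_degree :: "'a set \<Rightarrow> 'a set set \<Rightarrow> nat" where
  "max_degree V E = Max (insert 0 (vertex_degree E ` V))"

definition induced_edges :: "'a set set \<Rightarrow> 'a set \<Rightarrow> 'a set set" where
  "induced_edges E S = {e \<in> E. e \<subseteq> S}"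

definition total_coloring ::
  "'a set \<Rightarrow> 'a set set \<Rightarrow> 'c set \<Rightarrow> ('a + 'a set \<Rightarrow> 'c) \<Rightarrow> bool" where
  "total_coloring V E C f \<longleftrightarrow>
     f ` (V <+> E) \<subseteq> C \<and>
     (\<forall>u\<in>V. \<forall>v\<in>V. {u, v} \<in> E \<longrightarrow> f (Inl u) \<noteq> f (Inl v)) \<and>
     (\<forall>e\<in>E. \<forall>e'\<in>E. e \<noteq> e' \<and> e \<inter> e' \<noteq> {} \<longrightarrow> f (Inr e) \<noteq> f (Inr e')) \<and>
     (\<forall>e\<in>E. \<forall>v\<in>e. f (Inr e) \<noteq> f (Inl v))"

text \<open>For finite graphs it is enough to take colors from \<^typ>\<open>nat\<close>, since a total coloring
  can be composed with any injection of its finite image into \<^typ>\<open>nat\<close>. The lemma below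
  ensures that the minimum is attained.\<close>

definition total_chromatic_number :: "'a set \<Rightarrow> 'a set set \<Rightarrow> nat" where
  "total_chromatic_number V E =
     (LEAST k. \<exists>(C :: nat set) f. finite C \<and> card C = k \<and> total_coloring V E C f)"

lemma total_coloring_exists:
  assumes "fin_simple_graph V E"
  shows "\<exists>k (C :: nat set) f. finite C \<and> card C = k \<and> total_coloring V E C f"
proof -
  have V: "finite V" and E: "E \<subseteq> nsets V 2"
    using assms by (auto simp: fin_simple_graph_def)
  have "E \<subseteq> Pow V" using E by (auto simp: nsets_def)
  then have "finite E" using V by (meson finite_Pow_iff finite_subset)
  then have "finite (V <+> E)" using V by simp
  then obtain f :: "'a + 'a set \<Rightarrow> nat" where f: "inj_on f (V <+> E)"
    using finite_imp_inj_to_nat_seg by meson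
  have "total_coloring V E (f ` (V <+> E)) f"
    unfolding total_coloring_def
  proof (intro conjI ballI impI)
    fix u v assume "u \<in> V" "v \<in> V" "{u, v} \<in> E"
    moreover have "u \<noteq> v" using \<open>{u, v} \<in> E\<close> E by (auto simp: nsets_def)
    ultimately show "f (Inl u) \<noteq> f (Inl v)" by (simp add: inj_on_eq_iff[OF f] InlI InrI)
  next
    fix e e' assume "e \<in> E" "e' \<in> E" "e \<noteq> e' \<and> e \<inter> e' \<noteq> {}"
    then show "f (Inr e) \<noteq> f (Inr e')" by (simp add: inj_on_eq_iff[OF f] InlI InrI)
  next
    fix e v assume "e \<in> E" "v \<in> e"
    moreover have "v \<in> V" using calculation \<open>E \<subseteq> Pow V\<close> by blast
    ultimately show "f (Inr e) \<noteq> f (Inl v)" by (simp add: inj_on_eq_iff[OF f] InlI InrI)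
  qed simp
  moreover have "finite (f ` (V <+> E))" using \<open>finite (V <+> E)\<close> by (rule finite_imageI)
  ultimately show ?thesis by (intro exI conjI) (assumption | rule refl)+
qed

text \<open>List positions start at \<open>0\<close>, so \<open>v\<^sub>i\<close> is \<open>vs ! (i - 1)\<close>. The difference \<open>i - 2\<close> on
  \<^typ>\<open>nat\<close> is truncated only for \<open>i = 1\<close>, where it yields \<open>0\<close>, a value that is listed anyway.\<close>

definition mock_threshold :: "'a set \<Rightarrow> 'a set set \<Rightarrow> bool" where
  "mock_threshold V E \<longleftrightarrow>
     (\<exists>vs. distinct vs \<and> set vs = V \<and>
        (\<forall>i\<in>{1..card V}.
           vertex_degree (induced_edges E (set (take i vs))) (vs ! (i - 1)) \<in> {0, 1, i - 2, i - 1}))"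

end

theory Submission
  imports Defs "HOL-Combinatorics.Transposition"
begin

text \<open>
  Vertices are added in the given order, always with \<open>k = \<Delta>(G) + 2\<close> colors. A new vertex of
  degree at most one can be colored greedily. Otherwise the new vertex has degree at least
  \<open>i - 2\<close> in the current graph on \<open>i\<close> vertices, so that \<open>i \<le> k\<close>. Join an additional vertex
  \<open>w\<close> to all \<open>i\<close> vertices: then \<open>w\<close> has degree at most \<open>k\<close> and every other vertex has degree
  at most \<open>k - 1\<close>. Vizing's fan argument, carried out with fans at \<open>w\<close> after all edges that
  avoid \<open>w\<close> have been colored, gives an edge coloring with \<open>k\<close> colors, as only the other ends
  of the edges of a fan need a free color once all edges are colored. Coloring each \<open>v\<close> like the edge
  \<open>vw\<close> yields a total coloring.
\<close>

section \<open>Proper edge colorings and free colors\<close>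

definition proper_edge_coloring :: "'a set set \<Rightarrow> ('a set \<Rightarrow> 'c) \<Rightarrow> bool" where
  "proper_edge_coloring E c \<longleftrightarrow>
     (\<forall>e\<in>E. \<forall>e'\<in>E. e \<noteq> e' \<and> e \<inter> e' \<noteq> {} \<longrightarrow> c e \<noteq> c e')"

definition free_color :: "'a set set \<Rightarrow> ('a set \<Rightarrow> 'c) \<Rightarrow> 'a \<Rightarrow> 'c \<Rightarrow> bool" where
  "free_color E c u \<alpha> \<longleftrightarrow> (\<forall>e\<in>E. u \<in> e \<longrightarrow> c e \<noteq> \<alpha>)"

lemma proper_edge_coloringD:
  assumes "proper_edge_coloring E c" "e \<in> E" "e' \<in> E" "u \<in> e" "u \<in> e'" "c e = c e'"
  shows "e = e'"
  using assms unfolding proper_edge_coloring_def by blast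

lemma free_color_exists:
  assumes "finite E" "vertex_degree E u < card C"
  shows "\<exists>\<alpha>\<in>C. free_color E c u \<alpha>"
proof -
  let ?S = "{e \<in> E. u \<in> e}"
  have fin: "finite ?S" using assms(1) by simp
  have "card (c ` ?S) < card C"
    using card_image_le[OF fin, of c] assms(2) unfolding vertex_degree_def by linarith
  then have "\<not> C \<subseteq> c ` ?S"
    using card_mono[OF finite_imageI[OF fin], of C c] by linarith
  then obtain \<alpha> where "\<alpha> \<in> C" "\<alpha> \<notin> c ` ?S" by blast
  then show ?thesis unfolding free_color_def by (intro bexI[of _ \<alpha>]) auto
qed

lemma proper_edge_coloring_insert:
  assumes "proper_edge_coloring (E - {{u, v}}) c"
    and "free_color (E - {{u, v}}) c u \<alpha>" "free_color (E - {{u, v}}) c v \<alpha>"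
  shows "proper_edge_coloring E (c({u, v} := \<alpha>))"
  unfolding proper_edge_coloring_def
proof (intro ballI impI)
  fix e e' assume e: "e \<in> E" "e' \<in> E" "e \<noteq> e' \<and> e \<inter> e' \<noteq> {}"
  have D: "(c({u, v} := \<alpha>)) g \<noteq> \<alpha>" if "g \<in> E" "g \<noteq> {u, v}" "g \<inter> {u, v} \<noteq> {}" for g
    using that assms(2,3) unfolding free_color_def by auto
  show "(c({u, v} := \<alpha>)) e \<noteq> (c({u, v} := \<alpha>)) e'"
  proof (cases "e = {u, v} \<or> e' = {u, v}")
    case True
    then show ?thesis
      using D[of e] D[of e'] e by (metis Int_commute fun_upd_same)
  next
    case False
    then show ?thesis
      using assms(1) e unfolding proper_edge_coloring_def by auto
  qed
qed

section \<open>Two-colored subgraphs and Kempe changes\<close>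

text \<open>A proper coloring is injective on the edges at \<open>u\<close>, and a free color
  excludes one of the two values. The second bound recognizes the ends of Kempe chains.\<close>

lemma two_colored_degree_le:
  assumes "proper_edge_coloring E c"
  shows "vertex_degree {e \<in> E. c e \<in> {\<alpha>, \<beta>}} u \<le> 2"
    and "free_color E c u \<alpha> \<or> free_color E c u \<beta> \<Longrightarrow>
      vertex_degree {e \<in> E. c e \<in> {\<alpha>, \<beta>}} u \<le> 1"
proof -
  let ?S = "{e \<in> {e \<in> E. c e \<in> {\<alpha>, \<beta>}}. u \<in> e}"
  have inj: "inj_on c ?S"
    by (rule inj_onI, rule proper_edge_coloringD[OF assms, of _ _ u]) auto
  have "c ` ?S \<subseteq> {\<alpha>, \<beta>}" by auto
  then have "card ?S \<le> card {\<alpha>, \<beta>}"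
    by (intro card_inj_on_le[OF inj]) auto
  also have "\<dots> \<le> 2" by (simp add: card_insert_if)
  finally show "vertex_degree {e \<in> E. c e \<in> {\<alpha>, \<beta>}} u \<le> 2" by (simp add: vertex_degree_def)
  assume "free_color E c u \<alpha> \<or> free_color E c u \<beta>"
  then obtain \<gamma> where "c ` ?S \<subseteq> {\<gamma>}"
    unfolding free_color_def by blast
  then have "card ?S \<le> card {\<gamma>}"
    by (intro card_inj_on_le[OF inj]) auto
  then show "vertex_degree {e \<in> E. c e \<in> {\<alpha>, \<beta>}} u \<le> 1" by (simp add: vertex_degree_def)
qed

text \<open>Such a \<open>K\<close> is a union of connected components of the graph with edge set
  \<open>F\<close>. For two-colored \<open>F\<close> this replaces Kempe chains, so no paths have to
  be formalized.\<close>

definition edge_closed :: "'a set set \<Rightarrow> 'a set \<Rightarrow> bool" where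
  "edge_closed F K \<longleftrightarrow> (\<forall>e\<in>F. e \<subseteq> K \<or> e \<inter> K = {})"

lemma edge_closed_Compl: "edge_closed F K \<Longrightarrow> edge_closed F (- K)"
  unfolding edge_closed_def by blast

lemma vertex_degree_Diff:
  assumes "finite E" "e \<in> E" "v \<in> e"
  shows "Suc (vertex_degree (E - {e}) v) = vertex_degree E v"
proof -
  have "{g \<in> E - {e}. v \<in> g} = {g \<in> E. v \<in> g} - {e}" by blast
  moreover have "Suc (card ({g \<in> E. v \<in> g} - {e})) = card {g \<in> E. v \<in> g}"
    using assms by (intro card_Suc_Diff1) auto
  ultimately show ?thesis by (simp add: vertex_degree_def)
qed

lemma vertex_degree_mono:
  assumes "finite E" "F \<subseteq> E"
  shows "vertex_degree F v \<le> vertex_degree E v"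
  unfolding vertex_degree_def using assms by (intro card_mono) auto

lemma vertex_degree_eq_0: "finite E \<Longrightarrow> vertex_degree E v = 0 \<longleftrightarrow> (\<forall>e\<in>E. v \<notin> e)"
  by (auto simp: vertex_degree_def)

text \<open>A connected component of a graph with maximum degree two is a path or a cycle, so it
  has at most two vertices of degree at most one.\<close>

lemma edge_closed_separation:
  assumes "finite F" "\<forall>e\<in>F. card e = 2" "\<forall>v. vertex_degree F v \<le> 2"
    and "vertex_degree F u \<le> 1" "vertex_degree F y \<le> 1" "vertex_degree F z \<le> 1"
    and "u \<noteq> y" "u \<noteq> z" "y \<noteq> z"
  shows "\<exists>K. u \<in> K \<and> (y \<notin> K \<or> z \<notin> K) \<and> edge_closed F K"
  using assms
proof (induction "card F" arbitrary: F u)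
  case 0
  then have "edge_closed F {u}" by (simp add: edge_closed_def)
  then show ?case using 0(8,9) by (intro exI[of _ "{u}"]) simp
next
  case (Suc n)
  show ?case
  proof (cases "vertex_degree F u = 0")
    case True
    then have "edge_closed F {u}"
      using Suc.prems(1) by (auto simp: edge_closed_def vertex_degree_eq_0)
    then show ?thesis using Suc.prems(7) by (intro exI[of _ "{u}"]) simp
  next
    case False
    then obtain e where e: "e \<in> F" "u \<in> e" using vertex_degree_eq_0[OF Suc.prems(1)] by metis
    then obtain v where v: "e = {u, v}" "u \<noteq> v"
      using Suc.prems(2) by (metis card_2_iff doubleton_eq_iff insertE singletonD)
    \<comment> \<open>The path is walked from its end \<open>u\<close>: once \<open>e\<close> is
      deleted, \<open>v\<close> is an end of what remains.\<close>
    define F' where "F' = F - {e}"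
    have fin: "finite F'" using Suc.prems(1) by (simp add: F'_def)
    have le: "vertex_degree F' x \<le> vertex_degree F x" for x
      by (rule vertex_degree_mono) (auto simp: F'_def Suc.prems(1))
    have du: "vertex_degree F' u = 0"
      using vertex_degree_Diff[OF Suc.prems(1) e] Suc.prems(4) by (simp add: F'_def)
    have dv: "Suc (vertex_degree F' v) = vertex_degree F v"
      using vertex_degree_Diff[OF Suc.prems(1) e(1), of v] v by (simp add: F'_def)
    have dv1: "vertex_degree F' v \<le> 1" using dv Suc.prems(3) by (metis Suc_le_mono numeral_2_eq_2 One_nat_def)
    \<comment> \<open>Since \<open>u\<close> is isolated in \<open>F'\<close>, only \<open>e\<close>
      can touch the added vertex, and both its ends lie in \<open>insert u K\<close>.\<close>
    have closed: "edge_closed F (insert u K)" if "v \<in> K" "edge_closed F' K" for K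
      unfolding edge_closed_def
    proof
      fix g assume g: "g \<in> F"
      show "g \<subseteq> insert u K \<or> g \<inter> insert u K = {}"
      proof (cases "g = e")
        case True
        then show ?thesis using v that(1) by simp
      next
        case False
        then have "g \<in> F'" using g by (simp add: F'_def)
        then have "u \<notin> g" "g \<subseteq> K \<or> g \<inter> K = {}"
          using du that(2) unfolding vertex_degree_eq_0[OF fin] edge_closed_def by blast+
        then show ?thesis by auto
      qed
    qed
    show ?thesis
    proof (cases "v = y \<or> v = z")
      case True
      \<comment> \<open>The walk has reached one of \<open>y\<close> and \<open>z\<close>, where the
        path stops; the component \<open>{u, v}\<close> misses the other one.\<close>
      then have "vertex_degree F' v = 0" using dv Suc.prems(5,6) by auto
      then have "edge_closed F' {v}"
        using fin by (auto simp: edge_closed_def vertex_degree_eq_0)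
      then have "edge_closed F {u, v}" using closed[of "{v}"] by simp
      then show ?thesis using True Suc.prems(7-9) by (intro exI[of _ "{u, v}"]) auto
    next
      case False
      have c: "n = card F'" using Suc.hyps(2) e(1) Suc.prems(1) by (simp add: F'_def)
      have "\<exists>K. v \<in> K \<and> (y \<notin> K \<or> z \<notin> K) \<and> edge_closed F' K"
      proof (rule Suc.hyps(1)[OF c])
        show "\<forall>e\<in>F'. card e = 2" using Suc.prems(2) by (simp add: F'_def)
        show "\<forall>v. vertex_degree F' v \<le> 2" using Suc.prems(3) le order_trans by blast
        show "vertex_degree F' y \<le> 1" "vertex_degree F' z \<le> 1"
          using Suc.prems(5,6) le order_trans by blast+
      qed (use fin dv1 False Suc.prems(9) in auto)
      then obtain K where K: "v \<in> K" "y \<notin> K \<or> z \<notin> K" "edge_closed F' K" by blast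
      then show ?thesis
        using closed[of K] Suc.prems(7,8) by (intro exI[of _ "insert u K"]) auto
    qed
  qed
qed

text \<open>Edges with exactly one end in \<open>K\<close> are harmless: if \<open>K\<close> is
  closed under the edges colored \<open>\<alpha>\<close> or \<open>\<beta>\<close>, such edges have
  other colors, which the transposition fixes.\<close>

definition kempe_swap :: "'a set \<Rightarrow> 'c \<Rightarrow> 'c \<Rightarrow> ('a set \<Rightarrow> 'c) \<Rightarrow> 'a set \<Rightarrow> 'c" where
  "kempe_swap K \<alpha> \<beta> c e = (if e \<inter> K = {} then c e else transpose \<alpha> \<beta> (c e))"

lemma kempe_swap_outside:
  assumes "edge_closed {e \<in> E. c e \<in> {\<alpha>, \<beta>}} K" "e \<in> E" "u \<in> e" "u \<notin> K"
  shows "kempe_swap K \<alpha> \<beta> c e = c e"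
  using assms unfolding edge_closed_def kempe_swap_def transpose_def by auto

lemma kempe_swap_inside: "u \<in> e \<Longrightarrow> u \<in> K \<Longrightarrow> kempe_swap K \<alpha> \<beta> c e = transpose \<alpha> \<beta> (c e)"
  by (auto simp: kempe_swap_def)

text \<open>At each vertex all colors change by one and the same injection: the transposition inside
  \<open>K\<close>, the identity outside.\<close>

lemma proper_edge_coloring_kempe_swap:
  assumes "proper_edge_coloring E c" "edge_closed {e \<in> E. c e \<in> {\<alpha>, \<beta>}} K"
  shows "proper_edge_coloring E (kempe_swap K \<alpha> \<beta> c)"
  unfolding proper_edge_coloring_def
proof (intro ballI impI)
  fix e e' assume e: "e \<in> E" "e' \<in> E" "e \<noteq> e' \<and> e \<inter> e' \<noteq> {}"
  then obtain u where u: "u \<in> e" "u \<in> e'" by blast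
  have "c e \<noteq> c e'" using assms(1) e unfolding proper_edge_coloring_def by blast
  then show "kempe_swap K \<alpha> \<beta> c e \<noteq> kempe_swap K \<alpha> \<beta> c e'"
    using e(1,2) u
    by (cases "u \<in> K") (auto simp: kempe_swap_outside[OF assms(2)] kempe_swap_inside
      dest: transpose_eq_imp_eq)
qed

lemma free_color_kempe_swap:
  assumes "edge_closed {e \<in> E. c e \<in> {\<alpha>, \<beta>}} K"
  shows "u \<notin> K \<Longrightarrow> free_color E (kempe_swap K \<alpha> \<beta> c) u \<gamma> \<longleftrightarrow> free_color E c u \<gamma>"
    and "u \<in> K \<Longrightarrow> free_color E (kempe_swap K \<alpha> \<beta> c) u \<gamma> \<longleftrightarrow> free_color E c u (transpose \<alpha> \<beta> \<gamma>)"
proof -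
  show "u \<notin> K \<Longrightarrow> free_color E (kempe_swap K \<alpha> \<beta> c) u \<gamma> \<longleftrightarrow> free_color E c u \<gamma>"
    unfolding free_color_def using kempe_swap_outside[OF assms] by metis
  assume u: "u \<in> K"
  have "transpose \<alpha> \<beta> \<delta> = \<gamma> \<longleftrightarrow> \<delta> = transpose \<alpha> \<beta> \<gamma>" for \<delta>
    by (metis transpose_involutory)
  then show "free_color E (kempe_swap K \<alpha> \<beta> c) u \<gamma> \<longleftrightarrow> free_color E c u (transpose \<alpha> \<beta> \<gamma>)"
    using kempe_swap_inside[OF _ u] unfolding free_color_def by metis
qed

section \<open>Vizing fans and edge colorings\<close>

text \<open>Shifting the colors of a fan towards its first edge uncolors its last edge, which can then
  take the color that is free at both ends.\<close>

lemma fan_shift: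
  assumes "proper_edge_coloring (E - {{w, x}}) c" "c ` (E - {{w, x}}) \<subseteq> C"
    and "\<forall>y\<in>set (x # xs). {w, y} \<in> E" "distinct (x # xs)" "w \<notin> set (x # xs)"
    and "\<forall>i<length xs. free_color (E - {{w, x}}) c ((x # xs) ! i) (c {w, xs ! i})"
    and "\<alpha> \<in> C" "free_color (E - {{w, x}}) c w \<alpha>"
    and "free_color (E - {{w, x}}) c (last (x # xs)) \<alpha>"
  shows "\<exists>c'. proper_edge_coloring E c' \<and> c' ` E \<subseteq> C"
  using assms
proof (induction xs arbitrary: x c)
  case Nil
  have "proper_edge_coloring E (c({w, x} := \<alpha>))"
    using Nil.prems by (intro proper_edge_coloring_insert) auto
  moreover have "(c({w, x} := \<alpha>)) ` E \<subseteq> C" using Nil.prems(2,7) by auto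
  ultimately show ?case by blast
next
  case (Cons y ys)
  define E1 where "E1 = E - {{w, x}}"
  define E2 where "E2 = E - {{w, y}}"
  define \<beta> where "\<beta> = c {w, y}"
  \<comment> \<open>Under \<open>c'\<close> the uncolored edge is \<open>{w, y}\<close>, and
    \<open>y # ys\<close> is a fan for the induction hypothesis.\<close>
  define c' where "c' = c({w, x} := \<beta>)"
  have xy: "x \<noteq> y" "w \<noteq> x" "w \<noteq> y" using Cons.prems by auto
  then have ne: "{w, x} \<noteq> {w, y}" by (metis doubleton_eq_iff)
  have yE1: "{w, y} \<in> E1" using Cons.prems(3) ne by (auto simp: E1_def)
  have fx: "free_color E1 c x \<beta>" using Cons.prems(6) by (auto simp: E1_def \<beta>_def)
  have proper: "proper_edge_coloring E1 c" using Cons.prems(1) by (simp add: E1_def)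
  have E12: "E2 - {{w, x}} = E1 - {{w, y}}" by (auto simp: E1_def E2_def)
  have sub: "proper_edge_coloring (E1 - {{w, y}}) c"
    using proper by (auto simp: proper_edge_coloring_def)
  \<comment> \<open>By properness \<open>{w, y}\<close> is the only edge of color
    \<open>\<beta>\<close> at either of its ends.\<close>
  have fyw: "free_color (E1 - {{w, y}}) c v \<beta>" if "v \<in> {w, y}" for v
    using that proper_edge_coloringD[OF proper _ yE1] unfolding free_color_def \<beta>_def by blast
  have c'_ne: "c' e = c e" if "e \<noteq> {w, x}" for e using that by (simp add: c'_def)
  \<comment> \<open>Passing from \<open>E1\<close> with \<open>c\<close> to \<open>E2\<close> with
    \<open>c'\<close> adds a color only on \<open>{w, x}\<close>, hence only at \<open>w\<close> and
    \<open>x\<close>.\<close>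
  have free': "free_color E2 c' v \<gamma>" if "free_color E1 c v \<gamma>" "v \<noteq> x" "v \<noteq> w" for v \<gamma>
    unfolding free_color_def
  proof (intro ballI impI)
    fix e assume e: "e \<in> E2" "v \<in> e"
    then have ex: "e \<noteq> {w, x}" using that(2,3) by blast
    then have "e \<in> E1" using e(1) by (simp add: E1_def E2_def)
    then show "c' e \<noteq> \<gamma>" using that(1) e(2) c'_ne[OF ex] by (auto simp: free_color_def)
  qed
  show ?case
  proof (rule Cons.IH[of y c'])
    have "proper_edge_coloring E2 c'"
      unfolding c'_def
      by (rule proper_edge_coloring_insert; unfold E12)
         (use sub fyw fx in \<open>auto simp: free_color_def\<close>)
    then show "proper_edge_coloring (E - {{w, y}}) c'" by (simp add: E2_def)
    show "c' ` (E - {{w, y}}) \<subseteq> C"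
      using Cons.prems(2) yE1 by (auto simp: c'_def E1_def \<beta>_def)
    show "\<forall>i<length ys. free_color (E - {{w, y}}) c' ((y # ys) ! i) (c' {w, ys ! i})"
    proof (intro allI impI)
      fix i assume i: "i < length ys"
      have v: "(y # ys) ! i \<in> set (y # ys)" "ys ! i \<in> set ys" using i by (auto intro: nth_mem simp: nth_Cons')
      have "free_color E1 c ((y # ys) ! i) (c {w, ys ! i})"
        using Cons.prems(6)[rule_format, of "Suc i"] i by (simp add: E1_def)
      moreover have "{w, ys ! i} \<noteq> {w, x}" using v Cons.prems(4) xy by (metis distinct.simps(2) doubleton_eq_iff list.set_intros(2))
      moreover have "(y # ys) ! i \<noteq> x" "(y # ys) ! i \<noteq> w" using v Cons.prems(4,5) by auto
      ultimately show "free_color (E - {{w, y}}) c' ((y # ys) ! i) (c' {w, ys ! i})"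
        using free' c'_ne by (simp add: E2_def)
    qed
    have l: "last (y # ys) \<noteq> x" "last (y # ys) \<noteq> w"
      using last_in_set[of "y # ys"] Cons.prems(4,5) by (metis distinct.simps(2) list.distinct(1) list.set_intros(2))+
    then show "free_color (E - {{w, y}}) c' (last (y # ys)) \<alpha>"
      using free' Cons.prems(9) unfolding E1_def E2_def by simp
    have "\<beta> \<noteq> \<alpha>" using Cons.prems(8) yE1 unfolding free_color_def \<beta>_def E1_def by blast
    then show "free_color (E - {{w, y}}) c' w \<alpha>"
      using Cons.prems(8) unfolding free_color_def c'_def by auto
  qed (use Cons.prems in auto)
qed

text \<open>Vizing's fan argument. Fans are grown along a fixed choice \<open>m\<close> of free colors. If the next
  edge already belongs to the fan, then the last vertex and an earlier one share a free color
  \<open>d\<close>, and a Kempe change makes a color of \<open>w\<close> free at one of them.\<close>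

lemma edge_coloring_extend:
  assumes fin: "finite E" and card2: "\<forall>e\<in>E. card e = 2" and wx: "{w, x} \<in> E"
    and proper: "proper_edge_coloring (E - {{w, x}}) c" and C: "c ` (E - {{w, x}}) \<subseteq> C"
    and \<alpha>: "\<alpha> \<in> C" "free_color (E - {{w, x}}) c w \<alpha>"
    and nbr: "\<And>y. {w, y} \<in> E \<Longrightarrow> \<exists>\<beta>\<in>C. free_color (E - {{w, x}}) c y \<beta>"
  shows "\<exists>c'. proper_edge_coloring E c' \<and> c' ` E \<subseteq> C"
proof (rule ccontr)
  assume no: "\<nexists>c'. proper_edge_coloring E c' \<and> c' ` E \<subseteq> C"
  define E1 where "E1 = E - {{w, x}}"
  obtain m where m: "m y \<in> C" "free_color E1 c y (m y)" if "{w, y} \<in> E" for y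
    using nbr unfolding E1_def by metis
  have loop: "{w, w} \<notin> E" using card2 by fastforce
  have wE1: "c {w, y} \<noteq> \<alpha>" if "{w, y} \<in> E1" for y
    using that \<alpha>(2) unfolding free_color_def E1_def by blast
  \<comment> \<open>Position \<open>i\<close> of \<open>x # xs\<close> is the vertex just before
    \<open>xs ! i\<close>, so each edge has the chosen free color of the preceding vertex.\<close>
  define fan where "fan xs \<longleftrightarrow> distinct (x # xs) \<and> (\<forall>y\<in>set xs. {w, y} \<in> E1) \<and>
    (\<forall>i<length xs. c {w, xs ! i} = m ((x # xs) ! i))" for xs
  have fanE: "{w, y} \<in> E" if "fan xs" "y \<in> set (x # xs)" for xs y
    using that wx unfolding fan_def E1_def by auto
  have fan_w: "w \<notin> set (x # xs)" if "fan xs" for xs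
    using fanE[OF that] loop by blast
  \<comment> \<open>Prolonging every fan is absurd, as a fan cannot have more vertices than
    \<open>\<Union>E\<close>.\<close>
  have grow: "\<exists>z. fan (xs @ [z])" if xs: "fan xs" for xs
  proof -
    define y where "y = last (x # xs)"
    define d where "d = m y"
    have y_nth: "y = (x # xs) ! length xs" by (simp add: y_def last_conv_nth)
    have y: "{w, y} \<in> E" using fanE[OF xs] by (simp add: y_def)
    have fan_free: "\<forall>i<length xs. free_color E1 c ((x # xs) ! i) (c {w, xs ! i})"
      using xs m(2) fanE[OF xs] unfolding fan_def by (metis length_Cons less_SucI nth_mem)
    \<comment> \<open>Otherwise shifting the whole fan and giving \<open>d\<close> to its last edge
      would color \<open>E\<close>.\<close>
    have nd: "\<not> free_color E1 c w d"
      using fan_shift[of E w x c C xs d] no proper C fanE[OF xs] fan_w[OF xs] xs fan_free m[OF y]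
      unfolding E1_def fan_def d_def y_def by blast
    then obtain e where e: "e \<in> E1" "w \<in> e" "c e = d" unfolding free_color_def by blast
    then obtain z where "e = {w, z}"
      using card2 unfolding E1_def by (metis DiffD1 card_2_iff doubleton_eq_iff insertE singletonD)
    with e have z: "{w, z} \<in> E1" "c {w, z} = d" by auto
    have zx: "z \<noteq> x" using z by (auto simp: E1_def)
    have "z \<notin> set xs"
    proof
      assume "z \<in> set xs"
      then obtain j where j: "j < length xs" "xs ! j = z" by (metis in_set_conv_nth)
      \<comment> \<open>\<open>p\<close> precedes \<open>z\<close> in the fan, so its chosen free
        color is the color \<open>d\<close> of \<open>{w, z}\<close>, as for
        \<open>y\<close>.\<close>
      define p where "p = (x # xs) ! j"
      have p: "m p = d" using xs j z unfolding fan_def p_def by metis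
      have p_in: "p \<in> set (x # xs)" using j unfolding p_def by (metis length_Cons less_SucI nth_mem)
      have pE: "{w, p} \<in> E" using fanE[OF xs p_in] .
      have py: "p \<noteq> y" using xs j unfolding p_def y_nth fan_def
        by (metis length_Cons lessI less_SucI nat_neq_iff nth_eq_iff_index_eq)
      have wp: "w \<noteq> p" "w \<noteq> y" using pE y loop by auto
      have \<alpha>d: "\<alpha> \<noteq> d" using wE1 z by blast
      have prop1: "proper_edge_coloring E1 c" using proper by (simp add: E1_def)
      let ?F = "{e \<in> E1. c e \<in> {\<alpha>, d}}"
      \<comment> \<open>The color \<open>\<alpha>\<close> is free at \<open>w\<close>, and
        \<open>d\<close> at \<open>p\<close> and \<open>y\<close>: three chain ends, which cannot
        all lie in one component.\<close>
      have "\<exists>K. w \<in> K \<and> (p \<notin> K \<or> y \<notin> K) \<and> edge_closed ?F K"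
      proof (rule edge_closed_separation[of ?F w p y])
        show "finite ?F" using fin by (simp add: E1_def)
        show "\<forall>e\<in>?F. card e = 2" using card2 by (simp add: E1_def)
        show "\<forall>v. vertex_degree ?F v \<le> 2" using two_colored_degree_le(1)[OF prop1] by blast
        show "vertex_degree ?F w \<le> 1"
          by (rule two_colored_degree_le(2)[OF prop1]) (use \<alpha>(2) in \<open>simp add: E1_def\<close>)
        show "vertex_degree ?F p \<le> 1"
          by (rule two_colored_degree_le(2)[OF prop1]) (use m(2)[OF pE] p in simp)
        show "vertex_degree ?F y \<le> 1"
          by (rule two_colored_degree_le(2)[OF prop1]) (use m(2)[OF y] d_def in simp)
      qed (use wp py in auto)
      then obtain K where K: "w \<in> K" "p \<notin> K \<or> y \<notin> K" "edge_closed ?F K" by blast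
      have cl: "edge_closed ?F (- K)" using K(3) by (rule edge_closed_Compl)
      \<comment> \<open>Swapping outside \<open>K\<close> keeps all colors at \<open>w\<close> and
        makes \<open>\<alpha>\<close> free at whichever of \<open>p\<close> and \<open>y\<close> is
        not in \<open>K\<close>.\<close>
      define c' where "c' = kempe_swap (- K) \<alpha> d c"
      have c'w: "c' {w, v} = c {w, v}" if "{w, v} \<in> E1" for v
        unfolding c'_def by (rule kempe_swap_outside[OF cl that]) (use K in auto)
      have prop': "proper_edge_coloring (E - {{w, x}}) c'"
        using proper_edge_coloring_kempe_swap[OF prop1 cl] by (simp add: c'_def E1_def)
      have "d \<in> C" using m(1)[OF y] by (simp add: d_def)
      then have C': "c' ` (E - {{w, x}}) \<subseteq> C"
        using C \<alpha>(1) unfolding c'_def kempe_swap_def transpose_def by auto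
      have w': "free_color (E - {{w, x}}) c' w \<alpha>"
        using free_color_kempe_swap(1)[OF cl, of w \<alpha>] K(1) \<alpha>(2) by (simp add: c'_def E1_def)
      have end': "free_color (E - {{w, x}}) c' v \<alpha>" if "v \<notin> K" "m v = d" "{w, v} \<in> E" for v
        using free_color_kempe_swap(2)[OF cl, of v \<alpha>] m(2)[OF that(3)] that by (simp add: c'_def E1_def)
      \<comment> \<open>Fan edges other than \<open>{w, z}\<close> have neither color
        \<open>\<alpha>\<close>, free at \<open>w\<close>, nor \<open>d\<close>, used at
        \<open>w\<close> by \<open>{w, z}\<close>; so the swap preserves their condition. The one
        for \<open>{w, z}\<close> survives if \<open>p\<close> is in \<open>K\<close>.\<close>
      have step': "free_color (E - {{w, x}}) c' ((x # xs) ! i) (c' {w, xs ! i})"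
        if i: "i < length xs" "i \<noteq> j \<or> p \<in> K" for i
      proof -
        have iE: "{w, xs ! i} \<in> E1" using xs i unfolding fan_def by simp
        have fr: "free_color E1 c ((x # xs) ! i) (c {w, xs ! i})" using fan_free i by blast
        show ?thesis
        proof (cases "i = j")
          case True
          then show ?thesis
            using i(2) fr free_color_kempe_swap(1)[OF cl, of p] c'w[OF iE]
            by (simp add: p_def c'_def E1_def)
        next
          case False
          then have "xs ! i \<noteq> z"
            using i j xs unfolding fan_def by (metis distinct.simps(2) nth_eq_iff_index_eq)
          then have "{w, xs ! i} \<noteq> {w, z}" by (metis doubleton_eq_iff)
          then have "c {w, xs ! i} \<noteq> d"
            using proper_edge_coloringD[OF prop1 iE z(1), of w] z(2) by auto
          then have "transpose \<alpha> d (c {w, xs ! i}) = c {w, xs ! i}"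
            using wE1[OF iE] by (simp add: transpose_def)
          then show ?thesis
            using fr free_color_kempe_swap[OF cl, of "(x # xs) ! i" "c {w, xs ! i}"] c'w[OF iE]
            unfolding c'_def[symmetric] E1_def by (metis)
        qed
      qed
      show False
      proof (cases "p \<in> K")
        case True
        then have "\<exists>c'. proper_edge_coloring E c' \<and> c' ` E \<subseteq> C"
          using fan_shift[of E w x c' C xs \<alpha>] prop' C' fanE[OF xs] xs fan_w[OF xs] step' \<alpha>(1) w'
            end'[of y] K(2) y unfolding fan_def d_def y_def by blast
        with no show False by blast
      next
        case False
        \<comment> \<open>The fan is cut off at \<open>p\<close>, which drops the possibly broken
          condition at position \<open>j\<close>.\<close>
        let ?ys = "take j xs"
        have sub: "set (x # ?ys) \<subseteq> set (x # xs)" by (auto dest: in_set_takeD)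
        have "(x # ?ys) ! j = p" using j(1) unfolding p_def by (cases j) simp_all
        moreover have "length (x # ?ys) - 1 = j" using j(1) by simp
        ultimately have lst: "last (x # ?ys) = p"
          using last_conv_nth[of "x # ?ys"] by (metis list.distinct(1))
        have "\<exists>c'. proper_edge_coloring E c' \<and> c' ` E \<subseteq> C"
        proof (rule fan_shift[OF prop' C' _ _ _ _ \<alpha>(1) w'])
          show "\<forall>y\<in>set (x # ?ys). {w, y} \<in> E" using sub fanE[OF xs] by blast
          show "w \<notin> set (x # ?ys)" using sub fan_w[OF xs] by blast
          show "distinct (x # ?ys)" using xs unfolding fan_def by (auto dest: in_set_takeD)
          show "free_color (E - {{w, x}}) c' (last (x # ?ys)) \<alpha>"
            unfolding lst using end'[OF False p pE] .
          show "\<forall>i<length ?ys. free_color (E - {{w, x}}) c' ((x # ?ys) ! i) (c' {w, ?ys ! i})"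
          proof (intro allI impI)
            fix i assume "i < length ?ys"
            then have i: "i < j" by simp
            have "(x # ?ys) ! i = (x # xs) ! i" "?ys ! i = xs ! i" using i by (auto simp: nth_Cons')
            then show "free_color (E - {{w, x}}) c' ((x # ?ys) ! i) (c' {w, ?ys ! i})"
              using step'[of i] i j by simp
          qed
        qed
        with no show False by blast
      qed
    qed
    then have "fan (xs @ [z])"
      using xs z zx y_nth d_def unfolding fan_def
      by (auto simp: nth_append nth_Cons' less_Suc_eq)
    then show ?thesis ..
  qed
  have "\<exists>xs. fan xs \<and> length xs = n" for n
  proof (induction n)
    case 0
    have "fan []" by (simp add: fan_def)
    then show ?case by auto
  next
    case (Suc n)
    then show ?case using grow by (metis length_append_singleton)
  qed
  then obtain xs where xs: "fan xs" "length xs = Suc (card (\<Union>E))" by blast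
  have "finite (\<Union>E)" using fin card2 by (metis card.infinite finite_Union zero_neq_numeral)
  moreover have "set xs \<subseteq> \<Union>E" using fanE[OF xs(1)] by auto
  ultimately have "card (set xs) \<le> card (\<Union>E)" by (rule card_mono)
  then show False using xs distinct_card[of xs] unfolding fan_def by simp
qed

text \<open>The induction removes edges at \<open>w\<close> first, so they are colored last. The
  center of a fan gains a free color from its uncolored edge, which is why degree
  \<open>card C\<close> is tolerable at \<open>w\<close>.\<close>

lemma edge_coloring_exists:
  assumes "finite E" "\<forall>e\<in>E. card e = 2"
    and "\<And>v. v \<noteq> w \<Longrightarrow> vertex_degree E v < card C" "vertex_degree E w \<le> card C"
  shows "\<exists>c. proper_edge_coloring E c \<and> c ` E \<subseteq> C"
  using assms
proof (induction E rule: finite_psubset_induct)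
  case (psubset E)
  show ?case
  proof (cases "E = {}")
    case True
    then show ?thesis by (simp add: proper_edge_coloring_def)
  next
    case False
    obtain a b where ab: "{a, b} \<in> E" "a = w \<or> (\<forall>e\<in>E. w \<notin> e)"
    proof (cases "\<exists>e\<in>E. w \<in> e")
      case True
      then show ?thesis
        using psubset.prems(1) that by (metis card_2_iff insert_commute insertE singletonD)
    next
      case False
      then show ?thesis
        using psubset.prems(1) \<open>E \<noteq> {}\<close> that by (metis card_2_iff ex_in_conv)
    qed
    let ?E = "E - {{a, b}}"
    have le: "vertex_degree ?E v \<le> vertex_degree E v" for v
      using psubset.hyps by (intro vertex_degree_mono) auto
    have "\<exists>c. proper_edge_coloring ?E c \<and> c ` ?E \<subseteq> C"
    proof (rule psubset.IH)
      show "vertex_degree ?E v < card C" if "v \<noteq> w" for v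
        using le[of v] psubset.prems(2)[OF that] by linarith
      show "vertex_degree ?E w \<le> card C"
        using le[of w] psubset.prems(3) by linarith
    qed (use ab(1) psubset.prems(1) in auto)
    then obtain c where c: "proper_edge_coloring ?E c" "c ` ?E \<subseteq> C" by blast
    have "vertex_degree ?E a < vertex_degree E a"
      using vertex_degree_Diff[OF psubset.hyps ab(1), of a] by simp
    then have "vertex_degree ?E a < card C"
      using psubset.prems(2)[of a] psubset.prems(3) by (cases "a = w") auto
    then obtain \<alpha> where \<alpha>: "\<alpha> \<in> C" "free_color ?E c a \<alpha>"
      using free_color_exists[of ?E a C c] psubset.hyps by blast
    show ?thesis
    proof (rule edge_coloring_extend[OF psubset.hyps psubset.prems(1) ab(1) c \<alpha>])
      fix y assume y: "{a, y} \<in> E"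
      \<comment> \<open>If \<open>a = w\<close> this holds as there are no loops; otherwise no
        remaining edge contains \<open>w\<close>.\<close>
      have "y \<noteq> w" using y ab(2) psubset.prems(1) by fastforce
      then have "vertex_degree ?E y < card C" using psubset.prems(2) le le_less_trans by blast
      then show "\<exists>\<beta>\<in>C. free_color ?E c y \<beta>"
        using free_color_exists[of ?E y C c] psubset.hyps by blast
    qed
  qed
qed

section \<open>Extending total colorings by one vertex\<close>

lemma fin_simple_graph_finite_edges: "fin_simple_graph V E \<Longrightarrow> finite E"
  unfolding fin_simple_graph_def by (meson finite_imp_finite_nsets finite_subset)

text \<open>An edge coloring of the graph with an additional vertex \<open>None\<close> joined to all others is a
  total coloring, in which \<open>v\<close> has the color of the edge between \<open>v\<close> and \<open>None\<close>.\<close>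

lemma total_coloring_high_degree:
  fixes C :: "'c set"
  assumes G: "fin_simple_graph V E" and C: "finite C" "card V \<le> card C" "C \<noteq> {}"
    and deg: "\<forall>v\<in>V. vertex_degree E v + 2 \<le> card C"
  shows "\<exists>f. total_coloring V E C f"
proof -
  have V: "finite V" and EV: "\<And>e. e \<in> E \<Longrightarrow> e \<subseteq> V \<and> card e = 2"
    using G by (auto simp: fin_simple_graph_def nsets_def)
  have E: "finite E" using G by (rule fin_simple_graph_finite_edges)
  define A where "A = (`) Some ` E"
  define B where "B = (\<lambda>v. {None, Some v}) ` V"
  have "\<exists>c. proper_edge_coloring (A \<union> B) c \<and> c ` (A \<union> B) \<subseteq> C"
  proof (rule edge_coloring_exists[where w = None])
    show "finite (A \<union> B)" using E V by (simp add: A_def B_def)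
    show "\<forall>e\<in>A \<union> B. card e = 2"
      using EV by (auto simp: A_def B_def card_image)
    show "vertex_degree (A \<union> B) None \<le> card C"
    proof -
      have "{e \<in> A \<union> B. None \<in> e} = B" by (auto simp: A_def B_def)
      then show ?thesis
        using card_image_le[OF V] C(2) le_trans unfolding vertex_degree_def B_def by metis
    qed
    fix v :: "'a option" assume "v \<noteq> None"
    then obtain u where u: "v = Some u" by auto
    show "vertex_degree (A \<union> B) v < card C"
    proof (cases "u \<in> V")
      case True
      have "{e \<in> A \<union> B. v \<in> e} \<subseteq> insert {None, Some u} ((`) Some ` {e \<in> E. u \<in> e})"
        by (auto simp: A_def B_def u)
      then have "vertex_degree (A \<union> B) v \<le> card (insert {None, Some u} ((`) Some ` {e \<in> E. u \<in> e}))"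
        unfolding vertex_degree_def using E by (intro card_mono) auto
      also have "\<dots> \<le> Suc (card ((`) Some ` {e \<in> E. u \<in> e}))"
        using E by (simp add: card_insert_if)
      also have "\<dots> \<le> Suc (vertex_degree E u)"
        unfolding vertex_degree_def using E by (simp add: card_image_le)
      finally show ?thesis using deg True by force
    next
      case False
      \<comment> \<open>The degree bound is required for every element of the type; outside
        \<open>V\<close> the degree is 0, and \<open>C\<close> is nonempty.\<close>
      then have empty: "{e \<in> A \<union> B. v \<in> e} = {}" using EV by (auto simp: A_def B_def u)
      show ?thesis using C unfolding vertex_degree_def empty by (simp add: card_gt_0_iff)
    qed
  qed
  then obtain c where c: "proper_edge_coloring (A \<union> B) c" "c ` (A \<union> B) \<subseteq> C" by blast
  define f where "f = case_sum (\<lambda>v. c {None, Some v}) (\<lambda>e. c (Some ` e))"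
  have cD: "c e \<noteq> c e'" if "e \<in> A \<union> B" "e' \<in> A \<union> B" "e \<noteq> e'" "u \<in> e" "u \<in> e'" for e e' u
    using proper_edge_coloringD[OF c(1) that(1,2,4,5)] that(3) by blast
  \<comment> \<open>Each conflict becomes two edges with a common end: \<open>None\<close> for
    adjacent vertices, a copy \<open>Some u\<close> of an actual vertex in the other cases.\<close>
  have "total_coloring V E C f"
    unfolding total_coloring_def
  proof (intro conjI ballI impI)
    show "f ` (V <+> E) \<subseteq> C" using c(2) by (auto simp: f_def A_def B_def)
  next
    fix u v assume uv: "u \<in> V" "v \<in> V" "{u, v} \<in> E"
    then have "u \<noteq> v" using EV[of "{u, v}"] by auto
    then show "f (Inl u) \<noteq> f (Inl v)"
      using uv by (simp add: f_def) (rule cD[of _ _ None]; auto simp: B_def doubleton_eq_iff)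
  next
    fix e e' assume e: "e \<in> E" "e' \<in> E" "e \<noteq> e' \<and> e \<inter> e' \<noteq> {}"
    then obtain u where "u \<in> e" "u \<in> e'" by blast
    with e show "f (Inr e) \<noteq> f (Inr e')"
      by (simp add: f_def) (rule cD[of _ _ "Some u"]; auto simp: A_def inj_image_eq_iff)
  next
    fix e v assume e: "e \<in> E" "v \<in> e"
    have "Some ` e \<noteq> {None, Some v}" by auto
    with e EV[OF e(1)] show "f (Inr e) \<noteq> f (Inl v)"
      by (simp add: f_def) (rule cD[of _ _ "Some v"]; auto simp: A_def B_def)
  qed
  then show ?thesis by blast
qed

lemma total_coloring_add_isolated:
  assumes "total_coloring V E C f" "v \<notin> \<Union>E" "\<Union>E \<subseteq> V" "C \<noteq> {}"
  shows "\<exists>g. total_coloring (insert v V) E C g"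
proof -
  obtain a where a: "a \<in> C" using assms(4) by blast
  have "total_coloring (insert v V) E C (f(Inl v := a))"
    using assms a unfolding total_coloring_def by (auto simp: image_subset_iff Plus_def)
  then show ?thesis by blast
qed

text \<open>Greedy choice: the new edge avoids the color of \<open>u\<close> and those of the old
  edges at \<open>u\<close>; then \<open>v\<close> avoids only the colors of \<open>u\<close> and of
  the new edge.\<close>

lemma total_coloring_add_pendant:
  assumes f: "total_coloring V E C f" and E: "finite E" "\<Union>E \<subseteq> V"
    and uv: "u \<in> V" "v \<notin> V" and C: "vertex_degree E u + 3 \<le> card C"
  shows "\<exists>g. total_coloring (insert v V) (insert {u, v} E) C g"
proof -
  let ?S = "insert (f (Inl u)) ((\<lambda>e. f (Inr e)) ` {e \<in> E. u \<in> e})"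
  have "card ?S \<le> Suc (card ((\<lambda>e. f (Inr e)) ` {e \<in> E. u \<in> e}))"
    using E by (simp add: card_insert_if)
  also have "\<dots> \<le> Suc (vertex_degree E u)"
    unfolding vertex_degree_def using E by (simp add: card_image_le)
  finally have "card ?S < card C" using C by linarith
  moreover have "finite ?S" using E(1) by simp
  ultimately have "\<not> C \<subseteq> ?S" using card_mono[of ?S C] by linarith
  then obtain a where a: "a \<in> C" "a \<notin> ?S" by blast
  have "card {a, f (Inl u)} < card C"
    using C by (simp add: card_insert_if)
  then have "\<not> C \<subseteq> {a, f (Inl u)}" using card_mono[of "{a, f (Inl u)}" C] by force
  then obtain b where b: "b \<in> C" "b \<noteq> a" "b \<noteq> f (Inl u)" by blast
  let ?g = "f(Inl v := b, Inr {u, v} := a)"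
  have vE: "v \<notin> e" if "e \<in> E" for e using that E(2) uv(2) by blast
  then have uvE: "{u, v} \<notin> E" by blast
  have "u \<noteq> v" using uv by blast
  have "total_coloring (insert v V) (insert {u, v} E) C ?g"
    unfolding total_coloring_def
  proof (intro conjI ballI impI)
    show "?g ` (insert v V <+> insert {u, v} E) \<subseteq> C"
      using f a b unfolding total_coloring_def by (auto simp: image_subset_iff Plus_def)
  next
    fix p q assume pq: "p \<in> insert v V" "q \<in> insert v V" "{p, q} \<in> insert {u, v} E"
    show "?g (Inl p) \<noteq> ?g (Inl q)"
    proof (cases "{p, q} \<in> E")
      case True
      then have "p \<noteq> v" "q \<noteq> v" using vE by auto
      then show ?thesis using True pq f unfolding total_coloring_def by auto
    next
      case False
      then have "{p, q} = {u, v}" using pq(3) by blast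
      then show ?thesis using b \<open>u \<noteq> v\<close> by (auto simp: doubleton_eq_iff)
    qed
  next
    have D: "f (Inr e) \<noteq> a" if "e \<in> E" "e \<inter> {u, v} \<noteq> {}" for e
      using that a(2) vE by auto
    fix e e' assume e: "e \<in> insert {u, v} E" "e' \<in> insert {u, v} E" "e \<noteq> e' \<and> e \<inter> e' \<noteq> {}"
    show "?g (Inr e) \<noteq> ?g (Inr e')"
    proof (cases "e = {u, v} \<or> e' = {u, v}")
      case True
      then show ?thesis using D[of e] D[of e'] e by (metis Inl_Inr_False Int_commute fun_upd_apply insertE sum.inject(2))
    next
      case False
      then show ?thesis using e f unfolding total_coloring_def by auto
    qed
  next
    fix e p assume e: "e \<in> insert {u, v} E" "p \<in> e"
    show "?g (Inr e) \<noteq> ?g (Inl p)"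
      using e a b \<open>u \<noteq> v\<close> uvE vE f unfolding total_coloring_def by auto
  qed
  then show ?thesis by blast
qed

section \<open>Coloring along the mock threshold ordering\<close>

theorem theorem3p1:
  fixes V :: "'a set" and E :: "'a set set"
  assumes "fin_simple_graph V E" and "mock_threshold V E"
  shows "total_chromatic_number V E \<le> max_degree V E + 2"
proof -
  define k where "k = max_degree V E + 2"
  define C where "C = {..<k}"
  have C: "finite C" "card C = k" "C \<noteq> {}" by (auto simp: C_def k_def lessThan_empty_iff)
  have V: "finite V" and EV: "\<And>e. e \<in> E \<Longrightarrow> e \<subseteq> V \<and> card e = 2"
    using assms(1) by (auto simp: fin_simple_graph_def nsets_def)
  have E: "finite E" using assms(1) by (rule fin_simple_graph_finite_edges)
  obtain vs where vs: "distinct vs" "set vs = V" and mock: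
    "\<And>i. i \<in> {1..card V} \<Longrightarrow>
       vertex_degree (induced_edges E (set (take i vs))) (vs ! (i - 1)) \<in> {0, 1, i - 2, i - 1}"
    using assms(2) unfolding mock_threshold_def by blast
  have len: "length vs = card V" using vs distinct_card by metis
  \<comment> \<open>The number of colors is fixed by the maximum degree of the whole graph, which
    bounds the degrees in all induced subgraphs.\<close>
  have deg: "vertex_degree (induced_edges E S) v + 2 \<le> k" if "v \<in> V" for S v
  proof -
    have "vertex_degree (induced_edges E S) v \<le> vertex_degree E v"
      using E by (intro vertex_degree_mono) (auto simp: induced_edges_def)
    also have "\<dots> \<le> max_degree V E"
      unfolding max_degree_def using V that by (intro Max_ge) auto
    finally show ?thesis by (simp add: k_def)
  qed
  have "\<exists>f. total_coloring (set (take i vs)) (induced_edges E (set (take i vs))) C f"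
    if "i \<le> card V" for i
    using that
  proof (induction i)
    case 0
    have "induced_edges E {} = {}" using EV by (fastforce simp: induced_edges_def)
    then show ?case by (simp add: total_coloring_def Plus_def)
  next
    case (Suc i)
    define S where "S = set (take i vs)"
    define v where "v = vs ! i"
    define F where "F = induced_edges E S"
    define F' where "F' = induced_edges E (insert v S)"
    have i: "i < length vs" using Suc.prems len by simp
    have S': "set (take (Suc i) vs) = insert v S"
      using i by (simp add: take_Suc_conv_app_nth S_def v_def)
    have vS: "v \<notin> S"
      using distinct_take[OF vs(1), of "Suc i"] i
      by (simp add: take_Suc_conv_app_nth S_def v_def)
    have SV: "insert v S \<subseteq> V"
      using i vs(2) by (auto simp: S_def v_def dest: in_set_takeD)
    have cardS: "card (insert v S) = Suc i"
      using distinct_card[OF distinct_take[OF vs(1)], of "Suc i"] i S' by simp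
    have finF: "finite F" "finite F'" using E by (auto simp: F_def F'_def induced_edges_def)
    have FS: "\<Union>F \<subseteq> S" by (auto simp: F_def induced_edges_def)
    have F_eq: "F = {e \<in> F'. v \<notin> e}" using vS by (auto simp: F_def F'_def induced_edges_def)
    obtain f where f: "total_coloring S F C f" using Suc by (auto simp: S_def F_def)
    \<comment> \<open>The vertex at position \<open>i\<close> has number \<open>Suc i\<close>, which
      turns the two large values into \<open>i - 1\<close> and \<open>i\<close>.\<close>
    have "vertex_degree F' v \<in> {0, 1, i - 1, i}"
      using mock[of "Suc i"] Suc.prems S' by (simp add: F'_def v_def)
    then consider "vertex_degree F' v = 0" | "vertex_degree F' v = 1" | "i \<le> Suc (vertex_degree F' v)"
      by fastforce
    then have "\<exists>f. total_coloring (insert v S) F' C f"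
    proof cases
      case 1
      then have "F' = F" using F_eq finF by (auto simp: vertex_degree_eq_0)
      then show ?thesis
        using total_coloring_add_isolated[OF f _ FS C(3), of v] FS vS by auto
    next
      case 2
      then obtain e where e: "{e \<in> F'. v \<in> e} = {e}"
        unfolding vertex_degree_def by (metis card_1_singletonE)
      then have eF: "e \<in> F'" "v \<in> e" by auto
      then obtain u where u: "e = {u, v}" "u \<noteq> v"
        using EV[of e] unfolding F'_def induced_edges_def
        by (smt (verit) card_2_iff insert_commute insertE mem_Collect_eq singletonD)
      have uS: "u \<in> S" using eF u by (auto simp: F'_def induced_edges_def)
      have F': "F' = insert {u, v} F" using F_eq e u by auto
      have "F = F' - {e}" using F_eq e by auto
      \<comment> \<open>Not counting the new edge at \<open>u\<close> provides the third spare color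
        needed for the greedy step.\<close>
      then have "Suc (vertex_degree F u) = vertex_degree F' u"
        using vertex_degree_Diff[OF finF(2) eF(1), of u] u by simp
      then have "vertex_degree F u + 3 \<le> card C"
        using deg[of u "insert v S"] uS SV C(2) by (auto simp: F'_def)
      then show ?thesis
        unfolding F' by (intro total_coloring_add_pendant[OF f finF(1) FS uS vS])
    next
      case 3
      have "fin_simple_graph (insert v S) F'"
        using EV V SV finite_subset card_ge_0_finite
        by (fastforce simp: fin_simple_graph_def F'_def induced_edges_def nsets_def)
      \<comment> \<open>The large degree of \<open>v\<close> limits the number of vertices:
        \<open>Suc i\<close> is at most its degree plus 2.\<close>
      moreover have "card (insert v S) \<le> card C"
        using 3 cardS deg[of v "insert v S"] SV C(2) by (simp add: F'_def)
      moreover have "\<forall>u\<in>insert v S. vertex_degree F' u + 2 \<le> card C"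
        using deg SV C(2) unfolding F'_def by blast
      ultimately show ?thesis using total_coloring_high_degree C by blast
    qed
    then show ?case by (simp add: S' F'_def)
  qed
  then obtain f where "total_coloring (set (take (card V) vs)) (induced_edges E (set (take (card V) vs))) C f"
    by blast
  moreover have "induced_edges E V = E" using EV by (auto simp: induced_edges_def)
  ultimately have "total_coloring V E C f" using vs(2) len by simp
  then have "total_chromatic_number V E \<le> k"
    unfolding total_chromatic_number_def using C by (intro Least_le) blast
  then show ?thesis by (simp add: k_def)
qed

end
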